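(* Let $R_0\in\mathrm{SO}(3)$ and $k_{\rm e}>0$. Let $K_P,K_D\in\mathbb R^{3\times3}$ be any two matrices such that the $6\times6$ matrix $$\begin{bmatrix}0&I\\-K_P&-K_D\end{bmatrix}$$ is Hurwitz. Then the linear PD controller $$u(\Delta R,\Omega)=-K_P\,\mathrm{Skew}(R_0^T\Delta R)^\vee-K_D\Omega,\qquad \Delta R=R-R_0,$$ exponentially stabilizes the equilibrium point $(R,\Omega)=(R_0,0)$ (i.e. $(\Delta R,\Omega)=(0,0)$) for the linear system $$\Delta\dot R=R_0\hat\Omega-2k_{\rm e}R_0\,\mathrm{Sym}(R_0^T\Delta R),\qquad\dot\Omega=u,\qquad(\Delta R,\Omega)\in\mathbb R^{3\times3}\times\mathbb R^3.$$ Moreover, it exponentially stabilizes the equilibrium point $(R_0,0)$ for the rigid body system $$\dot R=R\hat\Omega,\qquad\dot\Omega=u,\qquad(R,\Omega)\in\mathrm{SO}(3)\times\mathbb R^3.$$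
   Context: $\mathrm{Sym}(A)=\frac12(A+A^T)$ and $\mathrm{Skew}(A)=\frac12(A-A^T)$ for a square matrix $A$. The hat map $\wedge:\mathbb R^3\to\mathfrak{so}(3)$ sends $\Omega=(\Omega_1,\Omega_2,\Omega_3)$ to $\hat\Omega=\begin{bmatrix}0&-\Omega_3&\Omega_2\\ \Omega_3&0&-\Omega_1\\ -\Omega_2&\Omega_1&0\end{bmatrix}$, and $\vee:\mathfrak{so}(3)\to\mathbb R^3$ is its inverse. A square matrix is Hurwitz if all its eigenvalues have negative real part. A feedback exponentially stabilizes an equilibrium $x_0$ if $x_0$ is a (locally) exponentially stable equilibrium of the closed-loop system: there are $C,c,\delta>0$ such that every closed-loop solution in the stated state space with $\|x(0)-x_0\|<\delta$ satisfies $\|x(t)-x_0\|\le Ce^{-ct}\|x(0)-x_0\|$ for all $t\ge0$, where $\|\cdot\|$ is the Euclidean (Frobenius) norm of $\mathbb R^{3\times3}\times\mathbb R^3$. Stability is understood locally. *)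

theory Defs
  imports "HOL-Analysis.Analysis"
begin

definition Sym :: "real^'n^'n \<Rightarrow> real^'n^'n" where
  "Sym A = (1/2) *\<^sub>R (A + transpose A)"

definition Skew :: "real^'n^'n \<Rightarrow> real^'n^'n" where
  "Skew A = (1/2) *\<^sub>R (A - transpose A)"

definition so3 :: "(real^3^3) set" where
  "so3 = {A. transpose A = - A}"

definition SO3 :: "(real^3^3) set" where
  "SO3 = {R. rotation_matrix R}"

definition hat :: "real^3 \<Rightarrow> real^3^3" where
  "hat w = vector [vector [0, - w$3, w$2],
                   vector [w$3, 0, - w$1],
                   vector [- w$2, w$1, 0]]"

text \<open>The value of \<open>vee\<close> is meaningful only on \<open>so3\<close>, the range of \<open>hat\<close>.\<close>

definition vee :: "real^3^3 \<Rightarrow> real^3" where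
  "vee = inv hat"

lemma bij_betw_hat: "bij_betw hat UNIV so3"
proof (rule bij_betw_imageI)
  show "inj hat"
    by (auto simp: inj_def hat_def vec_eq_iff forall_3)
  show "range hat = so3"
  proof (intro equalityI subsetI)
    fix A assume "A \<in> range hat"
    then show "A \<in> so3"
      by (auto simp: so3_def hat_def transpose_def vec_eq_iff forall_3)
  next
    fix A :: "real^3^3" assume "A \<in> so3"
    then have sk: "transpose A = - A"
      by (simp add: so3_def)
    have eq: "A$j$i = - A$i$j" for i j
      using arg_cong[OF sk, of "\<lambda>B. B$i$j"]
      by (simp only: transpose_def vec_lambda_beta uminus_vec_def)
    have diag: "A$i$i = 0" for i
      using eq[of i i] by linarith
    have "A = hat (vector [A$3$2, A$1$3, A$2$1])"
      using diag[of 1] diag[of 2] diag[of 3] eq[of 1 2] eq[of 1 3] eq[of 3 2]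
      by (simp only: hat_def vec_eq_iff forall_3 vector_3) simp
    then show "A \<in> range hat" by blast
  qed
qed

lemma Skew_in_so3: "Skew (A :: real^3^3) \<in> so3"
  by (simp add: so3_def Skew_def transpose_def vec_eq_iff field_simps)

text \<open>A block matrix is indexed by the disjoint sum of the index types of its blocks.\<close>

definition block_matrix ::
  "'a^'n^'n \<Rightarrow> 'a^'m^'n \<Rightarrow> 'a^'n^'m \<Rightarrow> 'a^'m^'m \<Rightarrow> 'a^('n + 'm)^('n + 'm)" where
  "block_matrix A B C D = (\<chi> i j.
     case i of
       Inl k \<Rightarrow> (case j of Inl l \<Rightarrow> A$k$l | Inr l \<Rightarrow> B$k$l)
     | Inr k \<Rightarrow> (case j of Inl l \<Rightarrow> C$k$l | Inr l \<Rightarrow> D$k$l))"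

definition eigenvalue :: "complex^'n^'n \<Rightarrow> complex \<Rightarrow> bool" where
  "eigenvalue A z \<longleftrightarrow> (\<exists>v. v \<noteq> 0 \<and> A *v v = z *s v)"

definition Hurwitz :: "real^'n^'n \<Rightarrow> bool" where
  "Hurwitz A \<longleftrightarrow> (\<forall>z. eigenvalue (map_matrix complex_of_real A) z \<longrightarrow> Re z < 0)"

definition solution_on ::
  "('a::real_normed_vector \<Rightarrow> 'a) \<Rightarrow> 'a set \<Rightarrow> real set \<Rightarrow> (real \<Rightarrow> 'a) \<Rightarrow> bool" where
  "solution_on F X I x \<longleftrightarrow>
     (\<forall>t\<in>I. x t \<in> X \<and> (x has_vector_derivative F (x t)) (at t within I))"

text \<open>Solutions on bounded time intervals are included, so that a solution escaping in finite
  time is not ignored; \<open>I = {0..}\<close> gives the estimate for all \<open>t \<ge> 0\<close>.\<close>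

definition exp_stable_equilibrium ::
  "('a::real_normed_vector \<Rightarrow> 'a) \<Rightarrow> 'a set \<Rightarrow> 'a \<Rightarrow> bool" where
  "exp_stable_equilibrium F X x0 \<longleftrightarrow>
     x0 \<in> X \<and> F x0 = 0 \<and>
     (\<exists>C>0. \<exists>c>0. \<exists>\<delta>>0. \<forall>I x.
        is_interval I \<and> 0 \<in> I \<and> I \<subseteq> {0..} \<and> solution_on F X I x \<and> norm (x 0 - x0) < \<delta> \<longrightarrow>
        (\<forall>t\<in>I. norm (x t - x0) \<le> C * exp (- c * t) * norm (x 0 - x0)))"

definition exp_stabilizes ::
  "('a \<Rightarrow> 'u) \<Rightarrow> ('a \<Rightarrow> 'u \<Rightarrow> 'a) \<Rightarrow> 'a set \<Rightarrow> 'a::real_normed_vector \<Rightarrow> bool" where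
  "exp_stabilizes k f X x0 \<longleftrightarrow> exp_stable_equilibrium (\<lambda>x. f x (k x)) X x0"

text \<open>The norm of \<open>real^3^3 \<times> real^3\<close> is the Euclidean one (Frobenius on the matrix part).\<close>

definition linear_system ::
  "real^3^3 \<Rightarrow> real \<Rightarrow> (real^3^3) \<times> (real^3) \<Rightarrow> real^3 \<Rightarrow> (real^3^3) \<times> (real^3)" where
  "linear_system R0 ke = (\<lambda>(\<Delta>R, \<Omega>) u.
     (R0 ** hat \<Omega> - (2 * ke) *\<^sub>R (R0 ** Sym (transpose R0 ** \<Delta>R)), u))"

definition rigid_body ::
  "(real^3^3) \<times> (real^3) \<Rightarrow> real^3 \<Rightarrow> (real^3^3) \<times> (real^3)" where
  "rigid_body = (\<lambda>(R, \<Omega>) u. (R ** hat \<Omega>, u))"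

definition PD_controller ::
  "real^3^3 \<Rightarrow> real^3^3 \<Rightarrow> real^3^3 \<Rightarrow> real^3^3 \<Rightarrow> real^3 \<Rightarrow> real^3" where
  "PD_controller R0 KP KD \<Delta>R \<Omega> =
     - (KP *v vee (Skew (transpose R0 ** \<Delta>R))) - KD *v \<Omega>"

end

theory Submission
  imports Defs "HOL-Computational_Algebra.Fundamental_Theorem_Algebra"
begin

text \<open>Both claims reduce to the constant matrix \<open>A\<close> with blocks \<open>0, I, - K\<^sub>P, - K\<^sub>D\<close>. Put
  \<open>Z = R\<^sub>0\<^sup>T \<Delta>R\<close> and let \<open>w\<close> be the axial vector of \<open>Skew Z\<close>, so that \<open>Z = Sym Z + hat w\<close>.

  For the linear system the two parts decouple: \<open>Sym Z\<close> satisfies \<open>S' = - 2 k\<^sub>e S\<close>, because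
  \<open>hat \<Omega>\<close> is skew, and \<open>(w, \<Omega>)\<close> satisfies the linear equation with matrix \<open>A\<close>.

  For the rigid body, \<open>I + Z = R\<^sub>0\<^sup>T R\<close> is orthogonal, which forces \<open>2 Sym Z = - Z\<^sup>T Z\<close>. The
  symmetric part is therefore of second order, and near the equilibrium \<open>(w, \<Omega>)\<close> alone controls
  the whole error. Since \<open>R\<^sub>0\<^sup>T R hat \<Omega> = hat \<Omega> + Z hat \<Omega>\<close>, the pair \<open>(w, \<Omega>)\<close> satisfies the linear
  equation with matrix \<open>A\<close> up to a quadratic remainder, the axial vector of \<open>Z hat \<Omega>\<close>.

  It remains to find a quadratic Lyapunov function for \<open>A\<close> (\<open>Hurwitz_lyapunov_form\<close>). A complex
  polynomial \<open>(X - \<lambda>\<^sub>1) \<cdots> (X - \<lambda>\<^sub>m)\<close> annihilates \<open>A\<close> and has only eigenvalues of \<open>A\<close> as roots.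
  The vectors \<open>z\<^sub>0 = x\<close>, \<open>z\<^sub>k = (A - \<lambda>\<^sub>k) z\<^sub>k\<^sub>-\<^sub>1\<close> then satisfy the triangular system
  \<open>z\<^sub>k\<^sub>-\<^sub>1' = \<lambda>\<^sub>k z\<^sub>k\<^sub>-\<^sub>1 + z\<^sub>k\<close> with \<open>z\<^sub>m = 0\<close>, so a sum of \<open>|z\<^sub>k|\<^sup>2\<close> with sufficiently fast growing
  weights decays (\<open>lyapunov_form_of_annihilated\<close>).

  A quadratic form that decays in a neighbourhood of an equilibrium and is bounded below
  by the squared distance gives exponential stability by Gronwall's inequality and a continuation
  argument (\<open>exp_stable_equilibrium_of_quadratic_lyapunov\<close>).\<close>

section \<open>Annihilating polynomials of complex matrices\<close>

text \<open>This is \<open>p(M) v\<close>, evaluated by Horner's scheme so that induction over \<open>pCons\<close> applies.\<close>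

definition mat_poly :: "complex^'n^'n \<Rightarrow> complex poly \<Rightarrow> complex^'n \<Rightarrow> complex^'n" where
  "mat_poly M p v = fold_coeffs (\<lambda>a w. a *s v + M *v w) p 0"

lemma mat_poly_0 [simp]: "mat_poly M 0 v = 0"
  by (simp add: mat_poly_def)

lemma mat_poly_pCons [simp]: "mat_poly M (pCons a p) v = a *s v + M *v mat_poly M p v"
  by (cases "a = 0 \<and> p = 0") (auto simp: mat_poly_def)

lemma mat_poly_add: "mat_poly M (p + q) v = mat_poly M p v + mat_poly M q v"
  by (induction p q rule: poly_induct2)
     (simp_all add: vector_sadd_rdistrib matrix_vector_right_distrib)

lemma mat_poly_smult: "mat_poly M (smult c p) v = c *s mat_poly M p v"
  by (induction p) (simp_all add: vector_add_ldistrib vector_scalar_commute)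

lemma mat_poly_mult: "mat_poly M (p * q) v = mat_poly M p (mat_poly M q v)"
  by (induction p) (simp_all add: mat_poly_add mat_poly_smult)

lemma mat_poly_sum: "mat_poly M (sum f S) v = (\<Sum>k\<in>S. mat_poly M (f k) v)"
  by (induction S rule: infinite_finite_induct) (simp_all add: mat_poly_add)

lemma mat_poly_monom: "mat_poly M (monom c k) v = c *s (((**) M ^^ k) (mat 1) *v v)"
  by (induction k)
     (simp_all add: monom_0 monom_Suc vector_scalar_commute flip: matrix_vector_mul_assoc)

text \<open>The powers of \<open>M\<close> lie in a finite-dimensional real vector space. The dependence argument is about
  a set of matrices, so a coincidence between two powers is treated separately.\<close>

lemma exists_annihilating_polynomial:
  fixes M :: "complex^'n^'n"
  shows "\<exists>p. p \<noteq> 0 \<and> (\<forall>v. mat_poly M p v = 0)"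
proof -
  define P where "P k = ((**) M ^^ k) (mat 1)" for k
  have mono: "mat_poly M (monom c k) v = c *s (P k *v v)" for c k v
    by (simp add: mat_poly_monom P_def)
  let ?N = "DIM(complex^'n^'n)"
  show ?thesis
  proof (cases "inj_on P {..?N}")
    case True
    then have "card (P ` {..?N}) > ?N"
      by (simp add: card_image)
    then have "dependent (P ` {..?N})"
      by (intro dependent_biggerset)
    then obtain u where "\<exists>X\<in>P ` {..?N}. u X \<noteq> 0" "(\<Sum>X\<in>P ` {..?N}. u X *\<^sub>R X) = 0"
      using real_vector.dependent_finite[of "P ` {..?N}"] by blast
    then have u: "\<exists>k\<le>?N. u (P k) \<noteq> 0" "(\<Sum>k\<le>?N. u (P k) *\<^sub>R P k) = 0"
      by (blast, simp only: sum.reindex[OF True] o_def)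
    define p where "p = (\<Sum>k\<le>?N. monom (complex_of_real (u (P k))) k)"
    have "coeff p k = u (P k)" if "k \<le> ?N" for k
      using that by (simp add: p_def coeff_sum)
    then have "p \<noteq> 0"
      using u(1) by (metis coeff_0 of_real_eq_0_iff)
    moreover have "mat_poly M p v = (\<Sum>k\<le>?N. u (P k) *\<^sub>R P k) *v v" for v
    proof -
      have "of_real a *s (X *v v) = (a *\<^sub>R X) *v v" for a and X :: "complex^'n^'n"
        by (simp add: vec_eq_iff matrix_vector_mult_def sum_distrib_left complex_eq_iff algebra_simps)
      moreover have "(\<Sum>k\<in>S. X k) *v v = (\<Sum>k\<in>S. X k *v v)" for S :: "nat set" and X :: "nat \<Rightarrow> complex^'n^'n"
        by (induction S rule: infinite_finite_induct) (simp_all add: matrix_vector_mult_add_rdistrib)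
      ultimately show ?thesis
        by (simp add: p_def mat_poly_sum mono)
    qed
    ultimately show ?thesis
      using u(2) by auto
  next
    case False
    then obtain i j where ij: "i \<noteq> j" "P i = P j"
      by (auto simp: inj_on_def)
    let ?p = "monom 1 i + monom (-1) j :: complex poly"
    have "coeff ?p i = 1"
      using ij by simp
    then have "?p \<noteq> 0"
      by (metis coeff_0 zero_neq_one)
    moreover have "mat_poly M ?p v = 0" for v
      by (simp add: mat_poly_add mono ij(2))
    ultimately show ?thesis
      by blast
  qed
qed

text \<open>A polynomial of least degree will do: if a root \<open>z\<close> were not an eigenvalue, then \<open>M - z\<close> would be
  injective, and the factor \<open>X - z\<close> could be cancelled.\<close>

lemma exists_annihilating_polynomial_eigenvalue_roots:
  fixes M :: "complex^'n^'n"
  shows "\<exists>p. p \<noteq> 0 \<and> (\<forall>v. mat_poly M p v = 0) \<and> (\<forall>z. poly p z = 0 \<longrightarrow> eigenvalue M z)"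
proof -
  obtain p where p: "p \<noteq> 0" "\<And>v. mat_poly M p v = 0"
    and min: "\<And>q. q \<noteq> 0 \<Longrightarrow> (\<And>v. mat_poly M q v = 0) \<Longrightarrow> degree p \<le> degree q"
    using exists_least_iff[of "\<lambda>n. \<exists>p. n = degree p \<and> p \<noteq> 0 \<and> (\<forall>v. mat_poly M p v = 0)"]
      exists_annihilating_polynomial[of M] by (metis (no_types, lifting) not_le)
  have "eigenvalue M z" if root: "poly p z = 0" for z
  proof (rule ccontr)
    assume no: "\<not> eigenvalue M z"
    obtain q where q: "p = [:-z, 1:] * q"
      using root unfolding poly_eq_0_iff_dvd dvd_def by blast
    have "q \<noteq> 0"
      using p(1) q by auto
    moreover have "mat_poly M q v = 0" for v
    proof -
      have "mat_poly M [:-z, 1:] (mat_poly M q v) = 0"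
        using p(2)[of v] unfolding q mat_poly_mult .
      then have "M *v mat_poly M q v = z *s mat_poly M q v"
        by (simp add: vec_eq_iff)
      then show ?thesis
        using no unfolding eigenvalue_def by blast
    qed
    moreover have "degree p = Suc (degree q)"
      unfolding q using \<open>q \<noteq> 0\<close> by (subst degree_mult_eq) auto
    ultimately show False
      using min[of q] by auto
  qed
  then show ?thesis
    using p by blast
qed

section \<open>Quadratic Lyapunov functions of Hurwitz matrices\<close>

text \<open>The inner product on \<open>complex^'n\<close> is the real part of the Hermitian one, so the imaginary part
  of an eigenvalue does not affect the growth of the norm.\<close>

lemma inner_scalar_mult: "v \<bullet> (c *s v) = Re c * (v \<bullet> v)" for v :: "complex^'n"
  by (simp add: inner_vec_def sum_distrib_left inner_complex_def algebra_simps)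

lemma linear_vector_smult: "linear (\<lambda>v. c *s v)" for c :: complex
  by (intro linearI) (simp_all add: vec_eq_iff algebra_simps)

text \<open>Induction on the degree of \<open>p\<close>, generalising over the observable \<open>z\<close>. Splitting off a root \<open>l\<close>
  leaves the observable \<open>z1 = (M - l) z\<close>, which is annihilated by the cofactor, and
  \<open>z\<close> evolves by \<open>z' = l z + z1\<close>. As \<open>Re l < 0\<close>, a large multiple of the form obtained for \<open>z1\<close>
  absorbs the coupling between \<open>z\<close> and \<open>z1\<close>.\<close>

lemma lyapunov_form_of_annihilated:
  fixes z :: "'a::euclidean_space \<Rightarrow> complex^'n"
  assumes "p \<noteq> 0" and "\<And>w. poly p w = 0 \<Longrightarrow> Re w < 0"
    and "linear z" and "\<And>x. z (A x) = M *v z x" and "\<And>x. mat_poly M p (z x) = 0"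
  shows "\<exists>B \<nu>. bilinear B \<and> (\<forall>x y. B x y = B y x) \<and> \<nu> > 0 \<and>
           (\<forall>x. (norm (z x))\<^sup>2 \<le> B x x \<and> B x (A x) \<le> - \<nu> * B x x)"
  using assms
proof (induction "degree p" arbitrary: p z)
  case 0
  then obtain a where a: "p = [:a:]" "a \<noteq> 0"
    by (metis degree_eq_zeroE pCons_0_0)
  have z0: "z x = 0" for x
    using "0.prems"(5)[of x] a by (simp add: vec_eq_iff)
  have "bilinear (\<lambda>(x::'a) (y::'a). 0::real)"
    by (simp add: bilinear_def linear_iff)
  then show ?case
    using z0 by (intro exI[of _ "\<lambda>x y. 0"] exI[of _ 1]) simp
next
  case (Suc n)
  have "\<not> constant (poly p)"
    using Suc.hyps(2) by (simp add: constant_degree)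
  then obtain l where l: "poly p l = 0"
    using fundamental_theorem_of_algebra by blast
  then obtain q where q: "p = [:-l, 1:] * q"
    unfolding poly_eq_0_iff_dvd dvd_def by blast
  have "q \<noteq> 0"
    using Suc.prems(1) q by auto
  then have deg: "n = degree q"
    using Suc.hyps(2) unfolding q by (subst (asm) degree_mult_eq) auto
  define \<mu> where "\<mu> = - Re l"
  have "\<mu> > 0"
    using Suc.prems(2)[OF l] by (simp add: \<mu>_def)
  define z1 where "z1 x = M *v z x - l *s z x" for x
  have bl1: "linear z1"
    unfolding z1_def
    using linear_compose_sub[OF linear_compose[OF Suc.prems(3) matrix_vector_mul_linear]
        linear_compose[OF Suc.prems(3) linear_vector_smult]] by (simp add: o_def)
  have int1: "z1 (A x) = M *v z1 x" for x
    by (simp add: z1_def Suc.prems(4) matrix_vector_mult_diff_distrib vector_scalar_commute)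
  have ann1: "mat_poly M q (z1 x) = 0" for x
  proof -
    have "z1 x = mat_poly M [:-l, 1:] (z x)"
      by (simp add: z1_def vec_eq_iff)
    then show ?thesis
      using Suc.prems(5)[of x] unfolding q by (metis mat_poly_mult mult.commute)
  qed
  obtain B1 \<nu>1 where B1: "bilinear B1" "\<And>x y. B1 x y = B1 y x" "\<nu>1 > 0"
      "\<And>x. (norm (z1 x))\<^sup>2 \<le> B1 x x" "\<And>x. B1 x (A x) \<le> - \<nu>1 * B1 x x"
    using Suc.hyps(1)[OF deg \<open>q \<noteq> 0\<close> _ bl1 int1 ann1] Suc.prems(2) unfolding q by auto
  \<comment> \<open>The coupling contributes \<open>|z1|\<^sup>2 / (2 \<mu>)\<close>; this weight makes it half of the decay of \<open>c B1\<close>.\<close>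
  define c where "c = 1 / (\<mu> * \<nu>1)"
  define B where "B x y = z x \<bullet> z y + c * B1 x y" for x y
  define \<nu> where "\<nu> = min (\<mu> / 2) (\<nu>1 / 2)"
  have "c > 0" "\<nu> > 0"
    using \<open>\<mu> > 0\<close> B1(3) by (auto simp: c_def \<nu>_def)
  have B1nn: "B1 x x \<ge> 0" for x
    using B1(4)[of x] by (meson order_trans zero_le_power2)
  have "bilinear B"
    using B1(1) Suc.prems(3) unfolding B_def bilinear_def linear_iff
    by (auto simp: inner_add_left inner_add_right algebra_simps)
  moreover have "B x y = B y x" for x y
    by (simp add: B_def inner_commute B1(2))
  moreover have "(norm (z x))\<^sup>2 \<le> B x x" for x
    using B1nn[of x] \<open>c > 0\<close> by (simp add: B_def power2_norm_eq_inner)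
  moreover have "B x (A x) \<le> - \<nu> * B x x" for x
  proof -
    define s where "s = norm (z x)"
    define s1 where "s1 = norm (z1 x)"
    have "z (A x) = l *s z x + z1 x"
      by (simp add: Suc.prems(4) z1_def)
    then have "z x \<bullet> z (A x) = - \<mu> * s\<^sup>2 + z x \<bullet> z1 x"
      by (simp add: inner_add_right inner_scalar_mult \<mu>_def s_def power2_norm_eq_inner)
    also have "\<dots> \<le> - \<mu> * s\<^sup>2 + s * s1"
      using norm_cauchy_schwarz[of "z x" "z1 x"] by (simp add: s_def s1_def)
    also have "s * s1 \<le> \<mu> / 2 * s\<^sup>2 + 1 / (2 * \<mu>) * s1\<^sup>2"
    proof -
      have "0 \<le> (\<mu> * s - s1)\<^sup>2 / (2 * \<mu>)"
        using \<open>\<mu> > 0\<close> by simp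
      also have "\<dots> = \<mu> / 2 * s\<^sup>2 + 1 / (2 * \<mu>) * s1\<^sup>2 - s * s1"
        using \<open>\<mu> > 0\<close> by (simp add: power2_eq_square field_simps)
      finally show ?thesis
        by simp
    qed
    also have "s1\<^sup>2 \<le> B1 x x"
      using B1(4) by (simp add: s1_def)
    finally have 1: "z x \<bullet> z (A x) \<le> - (\<mu> / 2) * s\<^sup>2 + 1 / (2 * \<mu>) * B1 x x"
      using \<open>\<mu> > 0\<close> by (simp add: divide_right_mono)
    have "c * B1 x (A x) \<le> c * (- \<nu>1 * B1 x x)"
      using B1(5)[of x] \<open>c > 0\<close> by (intro mult_left_mono) auto
    moreover have "1 / (2 * \<mu>) = c * (\<nu>1 / 2)"
      using \<open>\<mu> > 0\<close> B1(3) by (simp add: c_def)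
    note 1 = 1[unfolded this]
    moreover have "c * (- \<nu>1 * B1 x x) + c * (\<nu>1 / 2) * B1 x x = - (\<nu>1 / 2) * (c * B1 x x)"
      by (simp add: algebra_simps)
    ultimately have "B x (A x) \<le> - (\<mu> / 2) * s\<^sup>2 - (\<nu>1 / 2) * (c * B1 x x)"
      using 1 unfolding B_def by linarith
    also have "\<dots> \<le> - \<nu> * s\<^sup>2 - \<nu> * (c * B1 x x)"
    proof -
      have "\<nu> * s\<^sup>2 \<le> \<mu> / 2 * s\<^sup>2" "\<nu> * (c * B1 x x) \<le> \<nu>1 / 2 * (c * B1 x x)"
        using B1nn[of x] \<open>c > 0\<close> by (intro mult_right_mono; simp add: \<nu>_def)+
      then show ?thesis
        by simp
    qed
    also have "\<dots> = - \<nu> * B x x"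
      by (simp add: B_def s_def power2_norm_eq_inner algebra_simps)
    finally show ?thesis .
  qed
  ultimately show ?case
    using \<open>\<nu> > 0\<close> by blast
qed

lemma Hurwitz_lyapunov_form:
  fixes A :: "real^'n^'n"
  assumes "Hurwitz A"
  shows "\<exists>B \<nu>. bilinear B \<and> (\<forall>x y. B x y = B y x) \<and> \<nu> > 0 \<and>
           (\<forall>x. (norm x)\<^sup>2 \<le> B x x \<and> B x (A *v x) \<le> - \<nu> * B x x)"
proof -
  define M where "M = map_matrix complex_of_real A"
  define z :: "real^'n \<Rightarrow> complex^'n" where "z x = (\<chi> i. complex_of_real (x$i))" for x
  obtain p where p: "p \<noteq> 0" "\<And>v. mat_poly M p v = 0" "\<And>w. poly p w = 0 \<Longrightarrow> eigenvalue M w"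
    using exists_annihilating_polynomial_eigenvalue_roots[of M] by blast
  have "linear z"
    by (intro linearI) (simp_all add: z_def vec_eq_iff complex_eq_iff)
  moreover have "z (A *v x) = M *v z x" for x
    by (simp add: z_def M_def vec_eq_iff matrix_vector_mult_def map_matrix_def)
  moreover have "norm (z x) = norm x" for x
    by (simp add: z_def norm_vec_def)
  ultimately show ?thesis
    using lyapunov_form_of_annihilated[of p z "(*v) A" M] p assms
    unfolding Hurwitz_def M_def[symmetric] by simp
qed

section \<open>Exponential stability from a quadratic Lyapunov function\<close>

lemma exponential_decay_of_differential_inequality:
  fixes v v' :: "real \<Rightarrow> real"
  assumes "0 \<le> t"
    and deriv: "\<And>s. s \<in> {0..t} \<Longrightarrow> (v has_vector_derivative v' s) (at s within {0..t})"
    and le: "\<And>s. s \<in> {0..t} \<Longrightarrow> v' s \<le> - k * v s"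
  shows "v t \<le> exp (- k * t) * v 0"
proof (cases "t = 0")
  case False
  with assms(1) have "0 < t"
    by simp
  define w where "w s = exp (k * s) * v s" for s
  have "(w has_derivative (\<lambda>h. h * (exp (k * s) * (k * v s + v' s)))) (at s within {0..t})"
    if "0 \<le> s" "s \<le> t" for s
  proof -
    have "(v has_real_derivative v' s) (at s within {0..t})"
      using deriv[of s] that by (simp add: has_real_derivative_iff_has_vector_derivative)
    then have "(w has_real_derivative exp (k * s) * (k * v s + v' s)) (at s within {0..t})"
      unfolding w_def by (auto intro!: derivative_eq_intros simp: algebra_simps)
    then show ?thesis
      unfolding has_field_derivative_def
      by (rule has_derivative_eq_rhs) (simp add: fun_eq_iff mult.commute)
  qed
  from mvt_simple[OF \<open>0 < t\<close> this] obtain s where s: "s \<in> {0<..<t}"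
      "w t - w 0 = (t - 0) * (exp (k * s) * (k * v s + v' s))"
    by blast
  have "k * v s + v' s \<le> 0"
    using le[of s] s(1) by simp
  then have "w t \<le> w 0"
    using s(2) \<open>0 < t\<close> by (smt (verit) exp_gt_zero mult_nonneg_nonpos)
  then have "exp (- k * t) * w t \<le> exp (- k * t) * w 0"
    by simp
  then show ?thesis
    by (simp add: w_def exp_minus field_simps)
qed simp

text \<open>The hypotheses on \<open>Q\<close> hold only within distance \<open>\<eta>\<close> of \<open>x0\<close>. As long as a solution stays there,
  it is bounded by \<open>C\<close> times its initial distance; when that distance is below \<open>\<eta> / C\<close>, the bound
  is strictly less than \<open>\<eta>\<close>, so the solution can never reach the boundary.\<close>

lemma exp_stable_equilibrium_of_quadratic_lyapunov:
  fixes F :: "'a::euclidean_space \<Rightarrow> 'a"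
  assumes Q: "bilinear Q" "\<And>x y. Q x y = Q y x"
    and x0: "x0 \<in> X" "F x0 = 0"
    and pos: "\<eta> > 0" "a > 0" "c > 0"
    and lower: "\<And>x. x \<in> X \<Longrightarrow> norm (x - x0) \<le> \<eta> \<Longrightarrow>
                  a * (norm (x - x0))\<^sup>2 \<le> Q (x - x0) (x - x0)"
    and decay: "\<And>x. x \<in> X \<Longrightarrow> norm (x - x0) \<le> \<eta> \<Longrightarrow>
                  Q (x - x0) (F x) \<le> - c * Q (x - x0) (x - x0)"
  shows "exp_stable_equilibrium F X x0"
proof -
  interpret bounded_bilinear Q
    using Q(1) by (simp add: bilinear_conv_bounded_bilinear)
  obtain b where b: "b > 0" "\<And>x y. norm (Q x y) \<le> norm x * norm y * b"
    using pos_bounded by blast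
  \<comment> \<open>The summand 1 makes \<open>\<eta> / C < \<eta>\<close>, so that solutions start inside the neighbourhood.\<close>
  define C where "C = sqrt (b / a) + 1"
  have "C > 1"
    using b(1) pos by (simp add: C_def)
  have bC: "b / a \<le> C\<^sup>2"
    using b(1) pos by (simp add: C_def power2_sum)
  have est: "norm (x t - x0) \<le> C * exp (- c * t) * norm (x 0 - x0)"
    if sol: "\<And>s. s \<in> {0..t} \<Longrightarrow> x s \<in> X \<and>
                (x has_vector_derivative F (x s)) (at s within {0..t})"
      and small: "\<And>s. s \<in> {0..t} \<Longrightarrow> norm (x s - x0) \<le> \<eta>" and "0 \<le> t" for x t
  proof -
    have "((\<lambda>s. Q (x s - x0) (x s - x0)) has_vector_derivative 2 * Q (x s - x0) (F (x s)))
            (at s within {0..t})" if "s \<in> {0..t}" for s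
    proof -
      have "((\<lambda>s. x s - x0) has_vector_derivative F (x s)) (at s within {0..t})"
        using sol[OF that] by (auto intro!: derivative_eq_intros)
      from has_vector_derivative[OF this this] show ?thesis
        by (simp add: Q(2)[of "F (x s)"])
    qed
    then have "Q (x t - x0) (x t - x0) \<le> exp (- (2 * c) * t) * Q (x 0 - x0) (x 0 - x0)"
    proof (rule exponential_decay_of_differential_inequality[OF \<open>0 \<le> t\<close>])
      show "2 * Q (x s - x0) (F (x s)) \<le> - (2 * c) * Q (x s - x0) (x s - x0)"
        if "s \<in> {0..t}" for s
        using decay[of "x s"] sol[OF that] small[OF that] by simp
    qed
    also have "Q (x 0 - x0) (x 0 - x0) \<le> b * (norm (x 0 - x0))\<^sup>2"
      using b(2)[of "x 0 - x0" "x 0 - x0"] by (simp add: power2_eq_square mult.commute)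
    finally have "a * (norm (x t - x0))\<^sup>2 \<le> exp (- (2 * c) * t) * (b * (norm (x 0 - x0))\<^sup>2)"
      using lower[of "x t"] sol[of t] small[of t] \<open>0 \<le> t\<close> by simp
    then have "(norm (x t - x0))\<^sup>2 \<le> b / a * (exp (- (2 * c) * t) * (norm (x 0 - x0))\<^sup>2)"
      using pos by (simp add: field_simps)
    also have "\<dots> \<le> C\<^sup>2 * (exp (- (2 * c) * t) * (norm (x 0 - x0))\<^sup>2)"
      using bC by (intro mult_right_mono) auto
    also have "\<dots> = (C * exp (- c * t) * norm (x 0 - x0))\<^sup>2"
      by (simp add: power_mult_distrib exp_double[symmetric] mult_ac)
    finally show ?thesis
      by (rule power2_le_imp_le) (use \<open>C > 1\<close> in simp)
  qed
  have "norm (x t - x0) \<le> C * exp (- c * t) * norm (x 0 - x0)"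
    if I: "is_interval I" "0 \<in> I" "I \<subseteq> {0..}" and sol: "solution_on F X I x"
      and init: "norm (x 0 - x0) < \<eta> / C" and "t \<in> I" for I x t
  proof -
    have sub: "{0..s} \<subseteq> I" if "s \<in> I" for s
      using mem_is_interval_1_I[OF I(1,2) that] by auto
    have sol': "x r \<in> X \<and> (x has_vector_derivative F (x r)) (at r within {0..s})"
      if "s \<in> I" "r \<in> {0..s}" for r s
    proof -
      have "r \<in> I"
        using sub[OF that(1)] that(2) by blast
      then have "x r \<in> X" "(x has_vector_derivative F (x r)) (at r within I)"
        using sol by (simp_all add: solution_on_def)
      then show ?thesis
        using has_vector_derivative_within_subset[OF _ sub[OF that(1)]] by blast
    qed
    have "0 \<le> t"
      using I \<open>t \<in> I\<close> by auto
    have init': "norm (x 0 - x0) < \<eta>"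
    proof -
      have "\<eta> / C \<le> \<eta>"
        using \<open>C > 1\<close> pos by (simp add: divide_le_eq)
      then show ?thesis
        using init by simp
    qed
    have cont: "continuous_on {0..t} (\<lambda>s. norm (x s - x0))"
      using sol'[OF \<open>t \<in> I\<close>]
      by (intro continuous_intros continuous_on_vector_derivative) auto
    have small: "norm (x s - x0) < \<eta>" if "s \<in> {0..t}" for s
    proof (rule ccontr)
      assume "\<not> norm (x s - x0) < \<eta>"
      \<comment> \<open>The least element of \<open>K\<close> is the first time at which the distance \<open>\<eta>\<close> is reached.\<close>
      define K where "K = {0..t} \<inter> (\<lambda>s. norm (x s - x0)) -` {\<eta>..}"
      have "closed K"
        unfolding K_def using cont by (intro continuous_closed_preimage) auto
      then have "compact K"
        unfolding K_def by (simp add: compact_eq_bounded_closed bounded_Int)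
      moreover have "s \<in> K"
        using that \<open>\<not> _\<close> by (simp add: K_def)
      ultimately obtain s1 where s1: "s1 \<in> K" "\<And>r. r \<in> K \<Longrightarrow> s1 \<le> r"
        using compact_attains_inf[of K] by auto
      have before: "norm (x r - x0) < \<eta>" if "r \<in> {0..<s1}" for r
        using s1(2)[of r] s1(1) that by (auto simp: K_def not_le[symmetric])
      have "s1 \<in> {0..t}" and ge: "\<eta> \<le> norm (x s1 - x0)"
        using s1(1) by (auto simp: K_def)
      have "norm (x s1 - x0) = \<eta>"
      proof -
        have "continuous_on {0..s1} (\<lambda>s. norm (x s - x0))"
          using cont \<open>s1 \<in> {0..t}\<close> by (auto intro: continuous_on_subset)
        then obtain r where r: "0 \<le> r" "r \<le> s1" "norm (x r - x0) = \<eta>"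
          using IVT'[of "\<lambda>s. norm (x s - x0)" 0 \<eta> s1] init' ge \<open>s1 \<in> {0..t}\<close> by force
        with before[of r] have "r = s1"
          by force
        with r show ?thesis by simp
      qed
      then have "norm (x r - x0) \<le> \<eta>" if "r \<in> {0..s1}" for r
        using before[of r] that by (cases "r = s1") auto
      moreover have "s1 \<in> I"
        using sub[OF \<open>t \<in> I\<close>] \<open>s1 \<in> {0..t}\<close> by blast
      ultimately have "norm (x s1 - x0) \<le> C * exp (- c * s1) * norm (x 0 - x0)"
        using sol'[of s1] \<open>s1 \<in> {0..t}\<close> by (intro est) auto
      also have "\<dots> \<le> C * 1 * norm (x 0 - x0)"
        using \<open>C > 1\<close> pos \<open>s1 \<in> {0..t}\<close> by (intro mult_right_mono mult_left_mono) auto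
      also have "\<dots> < \<eta>"
        using init \<open>C > 1\<close> by (simp add: field_simps)
      finally show False
        using ge by simp
    qed
    show ?thesis
      using sol'[OF \<open>t \<in> I\<close>] small \<open>0 \<le> t\<close> by (intro est) (auto intro: less_imp_le)
  qed
  moreover have "C > 0" "\<eta> / C > 0"
    using \<open>C > 1\<close> pos by auto
  ultimately show ?thesis
    unfolding exp_stable_equilibrium_def using x0 pos(3) by blast
qed

section \<open>The closed-loop matrix\<close>

lemma bilinear_compose_linear:
  "bilinear h \<Longrightarrow> linear f \<Longrightarrow> linear g \<Longrightarrow> bilinear (\<lambda>x y. h (f x) (g y))"
  unfolding bilinear_def linear_iff by auto

lemma linear_compose_bilinear:
  "linear f \<Longrightarrow> bilinear h \<Longrightarrow> bilinear (\<lambda>x y. f (h x y))"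
  unfolding bilinear_def linear_iff by auto

lemma bilinear_matrix_mult: "bilinear ((**) :: real^'m^'n \<Rightarrow> real^'p^'m \<Rightarrow> real^'p^'n)"
  by (simp add: bilinear_def linear_iff vec_eq_iff matrix_matrix_mult_def
      sum.distrib sum_distrib_left algebra_simps)

definition join :: "(real^'n) \<times> (real^'m) \<Rightarrow> real^('n + 'm)" where
  "join p = (\<chi> i. case i of Inl k \<Rightarrow> fst p $ k | Inr k \<Rightarrow> snd p $ k)"

lemma linear_join: "linear join"
  by (simp add: linear_iff join_def vec_eq_iff split: sum.split)

lemma sum_UNIV_Plus:
  "(\<Sum>i\<in>UNIV. f i) = (\<Sum>k\<in>UNIV. f (Inl k)) + (\<Sum>k\<in>UNIV. f (Inr k))"
  for f :: "'n::finite + 'm::finite \<Rightarrow> 'c::comm_monoid_add"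
  by (subst UNIV_Plus_UNIV[symmetric], subst sum.Plus) (simp_all add: o_def)

lemma norm_join: "norm (join p) = norm p"
  by (cases p) (simp add: norm_Pair norm_vec_def L2_set_def join_def sum_UNIV_Plus sum_nonneg)

lemma block_matrix_mult_join:
  "block_matrix A B C D *v join (v, w) = join (A *v v + B *v w, C *v v + D *v w)"
  by (simp add: vec_eq_iff join_def block_matrix_def matrix_vector_mult_def sum_UNIV_Plus
      split: sum.split)

text \<open>The vector field \<open>(w, \<Omega>) \<mapsto> (\<Omega>, - K\<^sub>P w - K\<^sub>D \<Omega>)\<close> is the given block matrix in the coordinates
  supplied by \<open>join\<close>, so the Lyapunov form can be pulled back along \<open>join\<close>.\<close>

lemma PD_lyapunov_form:
  fixes KP KD :: "real^'n^'n"
  assumes "Hurwitz (block_matrix 0 (mat 1) (- KP) (- KD))"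
  obtains B :: "(real^'n) \<times> (real^'n) \<Rightarrow> (real^'n) \<times> (real^'n) \<Rightarrow> real" and \<nu>
  where "bilinear B" "\<And>p q. B p q = B q p" "\<nu> > 0" "\<And>p. (norm p)\<^sup>2 \<le> B p p"
    "\<And>w \<Omega>. B (w, \<Omega>) (\<Omega>, - (KP *v w) - KD *v \<Omega>) \<le> - \<nu> * B (w, \<Omega>) (w, \<Omega>)"
proof -
  obtain B \<nu> where B: "bilinear B" "\<And>x y. B x y = B y x" "\<nu> > 0"
      "\<And>x. (norm x)\<^sup>2 \<le> B x x"
      "\<And>x. B x (block_matrix 0 (mat 1) (- KP) (- KD) *v x) \<le> - \<nu> * B x x"
    using Hurwitz_lyapunov_form[OF assms] by blast
  have neg: "(- K) *v x = - (K *v x)" for K :: "real^'n^'n" and x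
    by (simp add: vec_eq_iff matrix_vector_mult_def sum_negf)
  show thesis
  proof (rule that[of "\<lambda>p q. B (join p) (join q)" \<nu>])
    show "bilinear (\<lambda>p q. B (join p) (join q))"
      by (rule bilinear_compose_linear[OF B(1) linear_join linear_join])
    show "(norm p)\<^sup>2 \<le> B (join p) (join p)" for p
      using B(4)[of "join p"] by (simp add: norm_join)
    show "B (join (w, \<Omega>)) (join (\<Omega>, - (KP *v w) - KD *v \<Omega>)) \<le> - \<nu> * B (join (w, \<Omega>)) (join (w, \<Omega>))"
      for w \<Omega>
      using B(5)[of "join (w, \<Omega>)"] by (simp add: block_matrix_mult_join neg)
  qed (use B in auto)
qed

section \<open>Symmetric and axial parts of the attitude error\<close>

lemma vee_hat: "vee (hat w) = w"
  using bij_betw_hat by (simp add: vee_def bij_betw_def)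

definition axial :: "real^3^3 \<Rightarrow> real^3" where
  "axial Z = vee (Skew Z)"

lemma axial_eq:
  "axial Z = vector [(Z$3$2 - Z$2$3) / 2, (Z$1$3 - Z$3$1) / 2, (Z$2$1 - Z$1$2) / 2]"
    (is "_ = ?w")
proof -
  have "Skew Z = hat ?w"
    by (simp add: Skew_def hat_def transpose_def vec_eq_iff forall_3 diff_divide_distrib)
  then show ?thesis
    by (simp add: axial_def vee_hat)
qed

lemma linear_axial: "linear axial"
  by (simp add: linear_iff axial_eq vec_eq_iff forall_3 field_simps)

lemma linear_hat: "linear hat"
  by (simp add: linear_iff hat_def vec_eq_iff forall_3)

lemma linear_Sym: "linear Sym"
  by (simp add: linear_iff Sym_def transpose_def vec_eq_iff field_simps)

lemma axial_hat: "axial (hat w) = w"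
  by (simp add: axial_eq hat_def vec_eq_iff forall_3)

lemma Sym_hat: "Sym (hat w) = 0"
  by (simp add: Sym_def hat_def transpose_def vec_eq_iff forall_3)

lemma Sym_Sym: "Sym (Sym Z) = Sym Z"
  by (simp add: Sym_def transpose_def vec_eq_iff field_simps)

lemma axial_Sym: "axial (Sym Z) = 0"
  by (simp add: axial_eq Sym_def transpose_def vec_eq_iff forall_3)

lemma Sym_plus_hat_axial: "Sym Z + hat (axial Z) = Z"
  by (simp add: axial_eq Sym_def hat_def transpose_def vec_eq_iff forall_3 field_simps)

definition sym_part :: "real^3^3 \<Rightarrow> (real^3^3) \<times> (real^3) \<Rightarrow> real^3^3" where
  "sym_part R0 e = Sym (transpose R0 ** fst e)"

definition pd_part :: "real^3^3 \<Rightarrow> (real^3^3) \<times> (real^3) \<Rightarrow> (real^3) \<times> (real^3)" where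
  "pd_part R0 e = (axial (transpose R0 ** fst e), snd e)"

lemma linear_body_error: "linear (\<lambda>e :: (real^3^3) \<times> (real^3). transpose R0 ** fst e)"
  using linear_compose[OF linear_fst, of "(**) (transpose R0)"] bilinear_matrix_mult
  by (auto simp: bilinear_def o_def)

lemma linear_sym_part: "linear (sym_part R0)"
  using linear_compose[OF linear_body_error linear_Sym, of R0]
  by (simp add: sym_part_def[abs_def] o_def)

lemma linear_pd_part: "linear (pd_part R0)"
  using linear_compose[OF linear_body_error linear_axial, of R0]
  by (simp add: pd_part_def[abs_def] o_def linear_iff)

lemma PD_controller_eq:
  "PD_controller R0 KP KD D \<Omega> = - (KP *v axial (transpose R0 ** D)) - KD *v \<Omega>"
  by (simp add: PD_controller_def axial_def)

lemma PD_controller_0: "PD_controller R0 KP KD 0 0 = 0"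
  using linear_0[OF linear_pd_part, of R0]
  by (simp add: PD_controller_eq pd_part_def zero_prod_def)

text \<open>The two parts determine the error, since \<open>Z = Sym Z + hat (axial Z)\<close> and \<open>R0\<close> is invertible; an
  injective linear map on a finite-dimensional space is bounded below.\<close>

lemma body_error_coordinates_bounded_below:
  assumes "orthogonal_matrix R0"
  obtains a where "a > 0" "\<And>e. a * norm e \<le> norm (sym_part R0 e, pd_part R0 e)"
proof -
  have "linear (\<lambda>e. (sym_part R0 e, pd_part R0 e))"
    using linear_sym_part linear_pd_part by (simp add: linear_iff)
  moreover have "inj (\<lambda>e. (sym_part R0 e, pd_part R0 e))"
  proof (rule injI)
    fix e f
    assume "(sym_part R0 e, pd_part R0 e) = (sym_part R0 f, pd_part R0 f)"
    then have "Sym (transpose R0 ** fst e) = Sym (transpose R0 ** fst f)"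
        "axial (transpose R0 ** fst e) = axial (transpose R0 ** fst f)" and snd: "snd e = snd f"
      by (simp_all add: sym_part_def pd_part_def)
    then have "transpose R0 ** fst e = transpose R0 ** fst f"
      by (metis Sym_plus_hat_axial)
    then have "R0 ** (transpose R0 ** fst e) = R0 ** (transpose R0 ** fst f)"
      by simp
    then have "fst e = fst f"
      using assms by (simp add: matrix_mul_assoc orthogonal_matrix_def)
    then show "e = f"
      using snd by (rule prod_eqI)
  qed
  ultimately show thesis
    by (rule linear_inj_bounded_below_pos) (rule that)
qed

section \<open>Stability of the two closed-loop systems\<close>

text \<open>The Lyapunov function is \<open>|Sym Z|\<^sup>2\<close> plus the form of the closed-loop matrix; the two summands decay
  independently of each other.\<close>

lemma linear_system_exp_stable:
  assumes R0: "orthogonal_matrix R0" and "ke > 0"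
    and H: "Hurwitz (block_matrix 0 (mat 1) (- KP) (- KD))"
  shows "exp_stabilizes (\<lambda>(\<Delta>R, \<Omega>). PD_controller R0 KP KD \<Delta>R \<Omega>)
           (linear_system R0 ke) UNIV (0, 0)"
proof -
  obtain B \<nu> where B: "bilinear B" "\<And>p q. B p q = B q p" "\<nu> > 0" "\<And>p. (norm p)\<^sup>2 \<le> B p p"
    "\<And>w \<Omega>. B (w, \<Omega>) (\<Omega>, - (KP *v w) - KD *v \<Omega>) \<le> - \<nu> * B (w, \<Omega>) (w, \<Omega>)"
    using PD_lyapunov_form[OF H] by metis
  obtain a where a: "a > 0" "\<And>e. a * norm e \<le> norm (sym_part R0 e, pd_part R0 e)"
    using body_error_coordinates_bounded_below[OF R0] by blast
  define F where "F = (\<lambda>x. linear_system R0 ke x (case x of (\<Delta>R, \<Omega>) \<Rightarrow> PD_controller R0 KP KD \<Delta>R \<Omega>))"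
  define Q where "Q e f = sym_part R0 e \<bullet> sym_part R0 f + B (pd_part R0 e) (pd_part R0 f)" for e f
  define c where "c = min (2 * ke) \<nu>"
  have Bnn: "B p p \<ge> 0" for p
    using B(4)[of p] by (meson order_trans zero_le_power2)
  have cancel: "transpose R0 ** (R0 ** X) = X" for X :: "real^3^3"
    using R0 by (simp add: matrix_mul_assoc orthogonal_matrix_def)
  have body: "transpose R0 ** fst (F (D, \<Omega>)) = hat \<Omega> - (2 * ke) *\<^sub>R Sym (transpose R0 ** D)" for D \<Omega>
  proof -
    have "fst (F (D, \<Omega>)) = R0 ** (hat \<Omega> - (2 * ke) *\<^sub>R Sym (transpose R0 ** D))"
      by (simp add: F_def linear_system_def bilinear_rsub[OF bilinear_matrix_mult]
          bilinear_rmul[OF bilinear_matrix_mult])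
    then show ?thesis
      by (simp add: cancel)
  qed
  have sym: "sym_part R0 (F e) = - (2 * ke) *\<^sub>R sym_part R0 e" for e
    by (cases e) (simp add: sym_part_def body linear_diff[OF linear_Sym] linear_cmul[OF linear_Sym]
        Sym_hat Sym_Sym)
  have pd: "pd_part R0 (F (D, \<Omega>)) =
      (\<Omega>, - (KP *v axial (transpose R0 ** D)) - KD *v \<Omega>)" for D \<Omega>
    by (simp add: pd_part_def body linear_diff[OF linear_axial] linear_cmul[OF linear_axial]
        axial_hat axial_Sym) (simp add: F_def linear_system_def PD_controller_eq)
  have "exp_stable_equilibrium F UNIV (0, 0)"
  proof (rule exp_stable_equilibrium_of_quadratic_lyapunov[of Q _ _ _ 1 "a\<^sup>2" c])
    have "bilinear (\<lambda>e f. sym_part R0 e \<bullet> sym_part R0 f)"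
      using bilinear_compose_linear[OF _ linear_sym_part linear_sym_part, of "(\<bullet>)"]
      by (simp add: bilinear_conv_bounded_bilinear bounded_bilinear_inner)
    moreover have "bilinear (\<lambda>e f. B (pd_part R0 e) (pd_part R0 f))"
      by (rule bilinear_compose_linear[OF B(1) linear_pd_part linear_pd_part])
    ultimately show "bilinear Q"
      unfolding Q_def bilinear_def by (auto intro: linear_compose_add)
    show "Q e f = Q f e" for e f
      unfolding Q_def by (subst B(2)) (simp add: inner_commute)
    show "F (0, 0) = 0"
      using linear_0[OF linear_sym_part, of R0] linear_0[OF linear_hat]
      by (simp add: F_def linear_system_def PD_controller_0 sym_part_def zero_prod_def
          bilinear_rzero[OF bilinear_matrix_mult])
    show "a\<^sup>2 > 0" "c > 0"
      using a(1) B(3) \<open>ke > 0\<close> by (auto simp: c_def)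
  next
    fix e :: "(real^3^3) \<times> (real^3)"
    have "(a * norm e)\<^sup>2 \<le> (norm (sym_part R0 e, pd_part R0 e))\<^sup>2"
      using a by (intro power_mono) auto
    also have "\<dots> \<le> Q e e"
      using B(4)[of "pd_part R0 e"] by (simp add: norm_Pair Q_def power2_norm_eq_inner)
    finally show "a\<^sup>2 * (norm (e - (0, 0)))\<^sup>2 \<le> Q (e - (0, 0)) (e - (0, 0))"
      by (simp add: power_mult_distrib flip: zero_prod_def)
    have "B (pd_part R0 e) (pd_part R0 (F e)) \<le> - \<nu> * B (pd_part R0 e) (pd_part R0 e)"
      using B(5) by (cases e) (simp add: pd, simp add: pd_part_def)
    then have "Q e (F e) \<le> - (2 * ke) * (sym_part R0 e \<bullet> sym_part R0 e)
        - \<nu> * B (pd_part R0 e) (pd_part R0 e)"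
      by (simp add: Q_def sym)
    also have "\<dots> \<le> - c * (sym_part R0 e \<bullet> sym_part R0 e) - c * B (pd_part R0 e) (pd_part R0 e)"
    proof -
      have "c * (sym_part R0 e \<bullet> sym_part R0 e) \<le> 2 * ke * (sym_part R0 e \<bullet> sym_part R0 e)"
        "c * B (pd_part R0 e) (pd_part R0 e) \<le> \<nu> * B (pd_part R0 e) (pd_part R0 e)"
        using Bnn by (intro mult_right_mono; simp add: c_def)+
      then show ?thesis
        by simp
    qed
    finally show "Q (e - (0, 0)) (F e) \<le> - c * Q (e - (0, 0)) (e - (0, 0))"
      by (simp add: Q_def algebra_simps flip: zero_prod_def)
  qed auto
  then show ?thesis
    unfolding exp_stabilizes_def F_def .
qed

text \<open>Here the form of the closed-loop matrix suffices as Lyapunov function, because on \<open>SO3\<close> the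
  symmetric part is quadratically small. The derivative acquires the remainder \<open>g\<close>, which is
  bilinear in the error and hence dominated by the decay close to the equilibrium.\<close>

lemma rigid_body_exp_stable:
  assumes "R0 \<in> SO3"
    and H: "Hurwitz (block_matrix 0 (mat 1) (- KP) (- KD))"
  shows "exp_stabilizes (\<lambda>(R, \<Omega>). PD_controller R0 KP KD (R - R0) \<Omega>)
           rigid_body (SO3 \<times> UNIV) (R0, 0)"
proof -
  have R0: "orthogonal_matrix R0"
    using assms(1) by (simp add: SO3_def rotation_matrix_def)
  obtain B \<nu> where B: "bilinear B" "\<And>p q. B p q = B q p" "\<nu> > 0" "\<And>p. (norm p)\<^sup>2 \<le> B p p"
    "\<And>w \<Omega>. B (w, \<Omega>) (\<Omega>, - (KP *v w) - KD *v \<Omega>) \<le> - \<nu> * B (w, \<Omega>) (w, \<Omega>)"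
    using PD_lyapunov_form[OF H] by metis
  obtain a where a: "a > 0" "\<And>e. a * norm e \<le> norm (sym_part R0 e, pd_part R0 e)"
    using body_error_coordinates_bounded_below[OF R0] by blast
  define F where "F = (\<lambda>x. rigid_body x (case x of (R, \<Omega>) \<Rightarrow> PD_controller R0 KP KD (R - R0) \<Omega>))"
  define g where "g e f = axial (transpose R0 ** fst e ** hat (snd f))"
    for e f :: "(real^3^3) \<times> (real^3)"
  define h where "h e f = transpose (transpose R0 ** fst e) ** (transpose R0 ** fst f)"
    for e f :: "(real^3^3) \<times> (real^3)"
  have lin_tr: "linear (transpose :: real^3^3 \<Rightarrow> real^3^3)"
    by (simp add: linear_iff transpose_def vec_eq_iff)
  have "bilinear g"
    unfolding g_def
    using linear_compose_bilinear[OF linear_axial bilinear_compose_linear[OF bilinear_matrix_mult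
          linear_body_error linear_compose[OF linear_snd linear_hat]]] by (simp add: o_def)
  then obtain K1 where K1: "K1 > 0" "\<And>e f. norm (g e f) \<le> K1 * norm e * norm f"
    using bilinear_bounded_pos by blast
  have "bilinear h"
    unfolding h_def
    using bilinear_compose_linear[OF bilinear_matrix_mult
          linear_compose[OF linear_body_error lin_tr] linear_body_error] by (simp add: o_def)
  then obtain K2 where K2: "K2 > 0" "\<And>e f. norm (h e f) \<le> K2 * norm e * norm f"
    using bilinear_bounded_pos by blast
  obtain K3 where K3: "K3 > 0" "\<And>p q. norm (B p q) \<le> K3 * norm p * norm q"
    using bilinear_bounded_pos[OF B(1)] by blast
  \<comment> \<open>The first bound keeps the symmetric part below \<open>a / 2\<close> times the error, see \<open>lower\<close>; the second
    keeps the remainder below half of the decay, see \<open>rem\<close>.\<close>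
  define \<eta> where "\<eta> = min (a / K2) (\<nu> * a / (4 * K1 * K3))"
  have unit: "transpose R0 ** R = mat 1 + transpose R0 ** (R - R0)" for R
    using R0 by (simp add: bilinear_rsub[OF bilinear_matrix_mult] orthogonal_matrix_def)
  have sym: "sym_part R0 (R - R0, \<Omega>) = - (1/2) *\<^sub>R h (R - R0, \<Omega>) (R - R0, \<Omega>)"
    if "R \<in> SO3" for R \<Omega>
  proof -
    define Z where "Z = transpose R0 ** (R - R0)"
    have "orthogonal_matrix (transpose R0 ** R)"
      using that R0 by (auto simp: SO3_def rotation_matrix_def intro: orthogonal_matrix_mul)
    then have "transpose (mat 1 + Z) ** (mat 1 + Z) = mat 1"
      unfolding Z_def unit[of R, symmetric] by (simp add: orthogonal_matrix_def)
    then have "Z + transpose Z + transpose Z ** Z = 0"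
      by (simp add: linear_add[OF lin_tr] bilinear_radd[OF bilinear_matrix_mult]
          bilinear_ladd[OF bilinear_matrix_mult] algebra_simps)
    then have "Z + transpose Z = - (transpose Z ** Z)"
      by (simp only: eq_neg_iff_add_eq_0)
    then show ?thesis
      by (simp add: sym_part_def h_def Sym_def flip: Z_def)
  qed
  have pd: "pd_part R0 (F (R, \<Omega>)) =
      (\<Omega>, - (KP *v axial (transpose R0 ** (R - R0))) - KD *v \<Omega>) + (g (R - R0, \<Omega>) (R - R0, \<Omega>), 0)"
    for R \<Omega>
  proof -
    have "transpose R0 ** (R ** hat \<Omega>) = hat \<Omega> + transpose R0 ** (R - R0) ** hat \<Omega>"
      by (subst matrix_mul_assoc, subst unit) (simp add: bilinear_ladd[OF bilinear_matrix_mult])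
    then show ?thesis
      by (simp add: pd_part_def F_def rigid_body_def PD_controller_eq g_def
          linear_add[OF linear_axial] axial_hat)
  qed
  have lower: "a / 2 * norm e \<le> norm (pd_part R0 e)"
    if "R \<in> SO3" "e = (R - R0, \<Omega>)" "norm e \<le> \<eta>" for R \<Omega> e
  proof -
    have "a * norm e \<le> norm (sym_part R0 e, pd_part R0 e)"
      by (rule a)
    also have "\<dots> \<le> norm (sym_part R0 e) + norm (pd_part R0 e)"
      by (rule norm_Pair_le)
    finally have "a * norm e \<le> norm (sym_part R0 e) + norm (pd_part R0 e)" .
    moreover have "norm (sym_part R0 e) \<le> 1/2 * (K2 * norm e * norm e)"
      using sym[OF that(1), of \<Omega>] K2(2)[of e e] by (simp add: that(2))
    moreover have "K2 * norm e * norm e \<le> a * norm e"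
    proof (rule mult_right_mono)
      have "norm e \<le> a / K2"
        using that(3) by (simp add: \<eta>_def)
      then show "K2 * norm e \<le> a"
        using K2(1) by (simp add: field_simps)
    qed simp
    ultimately show ?thesis
      by simp
  qed
  have "exp_stable_equilibrium F (SO3 \<times> UNIV) (R0, 0)"
  proof (rule exp_stable_equilibrium_of_quadratic_lyapunov[of
        "\<lambda>e f. B (pd_part R0 e) (pd_part R0 f)" _ _ _ \<eta> "(a / 2)\<^sup>2" "\<nu> / 2"])
    show "bilinear (\<lambda>e f. B (pd_part R0 e) (pd_part R0 f))"
      by (rule bilinear_compose_linear[OF B(1) linear_pd_part linear_pd_part])
    show "B (pd_part R0 e) (pd_part R0 f) = B (pd_part R0 f) (pd_part R0 e)" for e f
      by (rule B(2))
    show "F (R0, 0) = 0"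
      using linear_0[OF linear_hat]
      by (simp add: F_def rigid_body_def PD_controller_0 zero_prod_def
          bilinear_rzero[OF bilinear_matrix_mult])
    show "\<eta> > 0"
      using a(1) B(3) K1(1) K2(1) K3(1) by (simp add: \<eta>_def)
  next
    fix x :: "(real^3^3) \<times> (real^3)"
    assume "x \<in> SO3 \<times> UNIV" and small: "norm (x - (R0, 0)) \<le> \<eta>"
    then obtain R \<Omega> where x: "x = (R, \<Omega>)" "R \<in> SO3"
      by auto
    define e where "e = x - (R0, 0)"
    define y where "y = pd_part R0 e"
    have e: "e = (R - R0, \<Omega>)"
      by (simp add: e_def x)
    have low: "a / 2 * norm e \<le> norm y"
      unfolding y_def using lower[OF x(2) e] small by (simp add: e_def)
    have "(a / 2 * norm e)\<^sup>2 \<le> (norm y)\<^sup>2"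
      using low a(1) by (intro power_mono) auto
    also have "\<dots> \<le> B y y"
      by (rule B(4))
    finally show "(a / 2)\<^sup>2 * (norm (x - (R0, 0)))\<^sup>2
        \<le> B (pd_part R0 (x - (R0, 0))) (pd_part R0 (x - (R0, 0)))"
      unfolding power_mult_distrib y_def e_def .
    have "norm (g e e) \<le> K1 * \<eta> * (2 / a * norm y)"
    proof -
      have "norm e \<le> \<eta>"
        using small by (simp add: e_def)
      moreover have "norm e \<le> 2 / a * norm y"
        using low a(1) by (simp add: pos_le_divide_eq mult.commute)
      moreover have "0 \<le> \<eta>"
        using norm_ge_zero calculation(1) by (rule order_trans)
      ultimately have "K1 * norm e * norm e \<le> K1 * \<eta> * (2 / a * norm y)"
        using K1(1) by (intro mult_mono) auto
      then show ?thesis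
        using K1(2)[of e e] by linarith
    qed
    then have "K3 * norm y * norm (g e e) \<le> K3 * norm y * (K1 * \<eta> * (2 / a * norm y))"
      using K3(1) by (intro mult_left_mono) auto
    also have "\<dots> = (2 * K1 * K3 / a * \<eta>) * (norm y)\<^sup>2"
      by (simp only: power2_eq_square times_divide_eq_left times_divide_eq_right mult_ac)
    also have "\<dots> \<le> \<nu> / 2 * (norm y)\<^sup>2"
    proof (rule mult_right_mono)
      have "2 * K1 * K3 / a * \<eta> \<le> 2 * K1 * K3 / a * (\<nu> * a / (4 * K1 * K3))"
        using a(1) K1(1) K3(1) by (intro mult_left_mono) (auto simp: \<eta>_def)
      also have "\<dots> = \<nu> / 2"
        using a(1) K1(1) K3(1) by simp
      finally show "2 * K1 * K3 / a * \<eta> \<le> \<nu> / 2" .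
    qed simp
    also have "\<dots> \<le> \<nu> / 2 * B y y"
      using B(3) B(4)[of y] by simp
    finally have rem: "B y (g e e, 0) \<le> \<nu> / 2 * B y y"
      using K3(2)[of y "(g e e, 0)"] by (simp add: norm_Pair)
    have y: "y = (axial (transpose R0 ** (R - R0)), \<Omega>)"
      by (simp add: y_def e pd_part_def)
    have "B y (pd_part R0 (F x)) \<le> - \<nu> * B y y + B y (g e e, 0)"
      using B(5)[of "axial (transpose R0 ** (R - R0))" \<Omega>]
      unfolding x(1) pd bilinear_radd[OF B(1)] y e by (rule add_right_mono)
    with rem show "B (pd_part R0 (x - (R0, 0))) (pd_part R0 (F x))
        \<le> - (\<nu> / 2) * B (pd_part R0 (x - (R0, 0))) (pd_part R0 (x - (R0, 0)))"
      by (simp add: y_def e_def)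
  qed (use assms(1) a(1) B(3) in auto)
  then show ?thesis
    unfolding exp_stabilizes_def F_def .
qed

theorem mainTheorem3:
  fixes R0 KP KD :: "real^3^3" and ke :: real
  assumes "R0 \<in> SO3" and "ke > 0"
    and "Hurwitz (block_matrix 0 (mat 1) (- KP) (- KD))"
  shows "exp_stabilizes (\<lambda>(\<Delta>R, \<Omega>). PD_controller R0 KP KD \<Delta>R \<Omega>)
           (linear_system R0 ke) UNIV (0, 0) \<and>
         exp_stabilizes (\<lambda>(R, \<Omega>). PD_controller R0 KP KD (R - R0) \<Omega>)
           rigid_body (SO3 \<times> UNIV) (R0, 0)"
proof
  have "orthogonal_matrix R0"
    using assms(1) by (simp add: SO3_def rotation_matrix_def)
  then show "exp_stabilizes (\<lambda>(\<Delta>R, \<Omega>). PD_controller R0 KP KD \<Delta>R \<Omega>)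
      (linear_system R0 ke) UNIV (0, 0)"
    using assms(2,3) by (rule linear_system_exp_stable)
  show "exp_stabilizes (\<lambda>(R, \<Omega>). PD_controller R0 KP KD (R - R0) \<Omega>)
      rigid_body (SO3 \<times> UNIV) (R0, 0)"
    using assms(1,3) by (rule rigid_body_exp_stable)
qed

end
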